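(* Let $H$ and $K$ be separable Hilbert spaces, let $V=\{(V_i,v_i)\}_{i\in I}$ and $W=\{(W_j,w_j)\}_{j\in J}$ be fusion frames for $H$ and $K$ with bounds $(B_1,D_1)$ and $(B_2,D_2)$, and let $V'=\{(V'_i,v'_i)\}_{i\in I}$ and $W'=\{(W'_j,w'_j)\}_{j\in J}$ be alternative duals of $V$ and $W$, respectively. Then $V'\otimes W'=\{(V'_i\otimes W'_j,v'_iw'_j)\}_{(i,j)\in I\times J}$ is a fusion frame for $H\otimes K$.
   Context: $H\otimes K$ is the Hilbert space tensor product, with $\langle f\otimes g,f'\otimes g'\rangle=\langle f,f'\rangle\langle g,g'\rangle$; the tensor product $X\otimes Y$ of closed subspaces $X\subset H$, $Y\subset K$ is the corresponding closed subspace of $H\otimes K$. $P_X$ denotes the orthogonal projection onto a closed subspace $X$. A family $V=\{(V_i,v_i)\}_{i\in I}$ of closed subspaces of $H$ with weights $v_i>0$ is a fusion frame for $H$ with bounds $(B_1,D_1)$, $0<B_1\le D_1<\infty$, if $B_1\|f\|^2\le\sum_{i\in I}v_i^2\|P_{V_i}f\|^2\le D_1\|f\|^2$ for all $f\in H$; if only the upper inequality is required it is a fusion Bessel sequence in $H$ (similarly for $K$). The fusion frame operator of a fusion frame $V$ is the bounded invertible operator $S_Vf=\sum_{i\in I}v_i^2P_{V_i}f$. A fusion Bessel sequence $V'=\{(V'_i,v'_i)\}_{i\in I}$ in $H$ (with $v'_i>0$) is an alternative dual of the fusion frame $V$ if $f=\sum_{i\in I}v_iv'_i\,P_{V'_i}S_V^{-1}P_{V_i}f$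 for all $f\in H$ (similarly for $K$). $V'\otimes W'$ is a fusion frame for $H\otimes K$ if there exist $0<A\le B<\infty$ such that $A\|f\otimes g\|^2\le\sum_{i,j}(v'_i)^2(w'_j)^2\|P_{V'_i\otimes W'_j}(f\otimes g)\|^2\le B\|f\otimes g\|^2$ for all $f\otimes g\in H\otimes K$ (i.e. for all $f\in H$, $g\in K$). *)

theory Defs
  imports "HOL-Analysis.Analysis"
begin

(* The scalar field of a Hilbert space, real or complex. By the Gelfand-Mazur theorem these
   axioms have no models other than the reals (with the identity as conjugation) and the
   complex numbers (with the usual conjugation). *)
class rc_field = real_normed_field +
  fixes rcnj :: "'a \<Rightarrow> 'a"
  assumes rcnj_add: "rcnj (a + b) = rcnj a + rcnj b"
    and rcnj_mult: "rcnj (a * b) = rcnj a * rcnj b"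
    and mult_rcnj: "a * rcnj a = (norm a)\<^sup>2 *\<^sub>R 1"

instantiation real :: rc_field
begin
definition rcnj_real :: "real \<Rightarrow> real" where "rcnj_real a = a"
instance by standard (auto simp: rcnj_real_def power2_eq_square)
end

instantiation complex :: rc_field
begin
definition rcnj_complex :: "complex \<Rightarrow> complex" where "rcnj_complex a = cnj a"
instance
  by standard (auto simp: rcnj_complex_def scaleR_conv_of_real simp flip: complex_norm_square)
end

(* A Hilbert space is a Banach space (completeness comes from the type class) over a scalar
   field of class rc_field, together with an inner product, linear in its first argument, that
   induces the norm. *)
locale hilbert_space = vector_space scale
  for scale :: "'k::rc_field \<Rightarrow> 'a::banach \<Rightarrow> 'a" +
  fixes ip :: "'a \<Rightarrow> 'a \<Rightarrow> 'k"
  assumes scale_of_real: "scale (of_real r) x = r *\<^sub>R x"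
    and ip_add_left: "ip (x + y) z = ip x z + ip y z"
    and ip_scale_left: "ip (scale a x) y = a * ip x y"
    and ip_commute: "ip x y = rcnj (ip y x)"
    and ip_self: "ip x x = of_real ((norm x)\<^sup>2)"
begin

definition closed_subspace :: "'a set \<Rightarrow> bool" where
  "closed_subspace X \<longleftrightarrow> subspace X \<and> closed X"

definition proj :: "'a set \<Rightarrow> 'a \<Rightarrow> 'a" where
  "proj X f = (THE p. p \<in> X \<and> (\<forall>x\<in>X. ip (f - p) x = 0))"

definition weighted_subspaces :: "'i set \<Rightarrow> ('i \<Rightarrow> 'a set) \<Rightarrow> ('i \<Rightarrow> real) \<Rightarrow> bool" where
  "weighted_subspaces I V v \<longleftrightarrow> (\<forall>i\<in>I. closed_subspace (V i) \<and> 0 < v i)"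

(* Summability is required explicitly because infsum is 0 on families that are not summable. *)
definition fusion_frame ::
  "'i set \<Rightarrow> ('i \<Rightarrow> 'a set) \<Rightarrow> ('i \<Rightarrow> real) \<Rightarrow> real \<Rightarrow> real \<Rightarrow> bool" where
  "fusion_frame I V v B D \<longleftrightarrow>
     weighted_subspaces I V v \<and> 0 < B \<and> B \<le> D \<and>
     (\<forall>f. (\<lambda>i. (v i)\<^sup>2 * (norm (proj (V i) f))\<^sup>2) summable_on I \<and>
          B * (norm f)\<^sup>2 \<le> (\<Sum>\<^sub>\<infinity>i\<in>I. (v i)\<^sup>2 * (norm (proj (V i) f))\<^sup>2) \<and>
          (\<Sum>\<^sub>\<infinity>i\<in>I. (v i)\<^sup>2 * (norm (proj (V i) f))\<^sup>2) \<le> D * (norm f)\<^sup>2)"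

definition fusion_bessel :: "'i set \<Rightarrow> ('i \<Rightarrow> 'a set) \<Rightarrow> ('i \<Rightarrow> real) \<Rightarrow> bool" where
  "fusion_bessel I V v \<longleftrightarrow>
     weighted_subspaces I V v \<and>
     (\<exists>D>0. \<forall>f. (\<lambda>i. (v i)\<^sup>2 * (norm (proj (V i) f))\<^sup>2) summable_on I \<and>
          (\<Sum>\<^sub>\<infinity>i\<in>I. (v i)\<^sup>2 * (norm (proj (V i) f))\<^sup>2) \<le> D * (norm f)\<^sup>2)"

definition fusion_frame_operator ::
  "'i set \<Rightarrow> ('i \<Rightarrow> 'a set) \<Rightarrow> ('i \<Rightarrow> real) \<Rightarrow> 'a \<Rightarrow> 'a" where
  "fusion_frame_operator I V v f = (\<Sum>\<^sub>\<infinity>i\<in>I. (v i)\<^sup>2 *\<^sub>R proj (V i) f)"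

definition alternative_dual ::
  "'i set \<Rightarrow> ('i \<Rightarrow> 'a set) \<Rightarrow> ('i \<Rightarrow> real) \<Rightarrow> ('i \<Rightarrow> 'a set) \<Rightarrow> ('i \<Rightarrow> real) \<Rightarrow> bool" where
  "alternative_dual I V v V' v' \<longleftrightarrow>
     fusion_bessel I V' v' \<and>
     (\<forall>f. ((\<lambda>i. (v i * v' i) *\<^sub>R
               proj (V' i) (inv (fusion_frame_operator I V v) (proj (V i) f))) has_sum f) I)"

end

(* The Hilbert space tensor product of H and K: a Hilbert space T with a bilinear map from
   H x K that is multiplicative on inner products and whose range spans a dense subspace.
   This determines T up to a unique unitary compatible with the simple tensors. *)
locale hilbert_tensor =
  H: hilbert_space scaleH ipH + K: hilbert_space scaleK ipK + T: hilbert_space scaleT ipT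
  for scaleH :: "'k::rc_field \<Rightarrow> 'a::banach \<Rightarrow> 'a" and ipH :: "'a \<Rightarrow> 'a \<Rightarrow> 'k"
    and scaleK :: "'k \<Rightarrow> 'b::banach \<Rightarrow> 'b" and ipK :: "'b \<Rightarrow> 'b \<Rightarrow> 'k"
    and scaleT :: "'k \<Rightarrow> 'c::banach \<Rightarrow> 'c" and ipT :: "'c \<Rightarrow> 'c \<Rightarrow> 'k" +
  fixes tensor :: "'a \<Rightarrow> 'b \<Rightarrow> 'c"
  assumes tensor_add_left: "tensor (f + f') g = tensor f g + tensor f' g"
    and tensor_add_right: "tensor f (g + g') = tensor f g + tensor f g'"
    and tensor_scale_left: "tensor (scaleH a f) g = scaleT a (tensor f g)"
    and tensor_scale_right: "tensor f (scaleK a g) = scaleT a (tensor f g)"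
    and ip_tensor: "ipT (tensor f g) (tensor f' g') = ipH f f' * ipK g g'"
    and tensor_dense: "closure (T.span {tensor f g | f g. True}) = UNIV"
begin

definition tensor_subspace :: "'a set \<Rightarrow> 'b set \<Rightarrow> 'c set" where
  "tensor_subspace X Y = closure (T.span {tensor x y | x y. x \<in> X \<and> y \<in> Y})"

(* The family (V i tensor W j, v i * w j) is a fusion frame for the tensor product; the frame
   inequalities range over the simple tensors only. *)
definition tensor_fusion_frame ::
  "'i set \<Rightarrow> 'j set \<Rightarrow> ('i \<Rightarrow> 'a set) \<Rightarrow> ('i \<Rightarrow> real) \<Rightarrow> ('j \<Rightarrow> 'b set) \<Rightarrow> ('j \<Rightarrow> real) \<Rightarrow> bool" where
  "tensor_fusion_frame I J V v W w \<longleftrightarrow>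
     T.weighted_subspaces (I \<times> J) (\<lambda>(i, j). tensor_subspace (V i) (W j)) (\<lambda>(i, j). v i * w j) \<and>
     (\<exists>A B. 0 < A \<and> A \<le> B \<and>
       (\<forall>f g. (\<lambda>(i, j). (v i)\<^sup>2 * (w j)\<^sup>2 *
                 (norm (T.proj (tensor_subspace (V i) (W j)) (tensor f g)))\<^sup>2)
               summable_on (I \<times> J) \<and>
         A * (norm (tensor f g))\<^sup>2 \<le>
           (\<Sum>\<^sub>\<infinity>(i, j)\<in>I \<times> J. (v i)\<^sup>2 * (w j)\<^sup>2 *
              (norm (T.proj (tensor_subspace (V i) (W j)) (tensor f g)))\<^sup>2) \<and>
         (\<Sum>\<^sub>\<infinity>(i, j)\<in>I \<times> J. (v i)\<^sup>2 * (w j)\<^sup>2 *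
              (norm (T.proj (tensor_subspace (V i) (W j)) (tensor f g)))\<^sup>2)
           \<le> B * (norm (tensor f g))\<^sup>2))"

end

lemma hilbert_space_euclidean:
  "hilbert_space (scaleR :: real \<Rightarrow> 'a \<Rightarrow> 'a) (inner :: 'a::euclidean_space \<Rightarrow> 'a \<Rightarrow> real)"
  by unfold_locales
    (auto simp: algebra_simps inner_commute rcnj_real_def dot_square_norm)

(* Non-vacuity: the outer product is a tensor product of Euclidean spaces. *)
lemma hilbert_tensor_outer_product:
  "hilbert_tensor (scaleR :: real \<Rightarrow> real^'n \<Rightarrow> real^'n) inner
     (scaleR :: real \<Rightarrow> real^'m \<Rightarrow> real^'m) inner
     (scaleR :: real \<Rightarrow> real^'m^'n \<Rightarrow> real^'m^'n) inner
     (\<lambda>x y. \<chi> i j. x $ i * y $ j)"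
proof -
  let ?t = "\<lambda>(x::real^'n) (y::real^'m). (\<chi> i j. x $ i * y $ j) :: real^'m^'n"
  have "A \<in> span {?t f g | f g. True}" for A :: "real^'m^'n"
  proof -
    have "A = (\<Sum>i\<in>UNIV. ?t (axis i 1) (A $ i))"
      by (simp add: vec_eq_iff axis_def if_distrib[of "\<lambda>c. c * _"] cong: if_cong)
    moreover have "\<dots> \<in> span {?t f g | f g. True}"
      by (rule span_sum, rule span_base) blast
    ultimately show ?thesis by metis
  qed
  hence "span {?t f g | f g. True} = UNIV" by blast
  hence dense: "closure (span {?t f g | f g. True}) = UNIV" by simp
  have ip: "inner (?t f g) (?t f' g') = inner f f' * inner g g'" for f f' g g'
    by (simp add: inner_vec_def sum_product) (intro sum.cong refl, simp add: mult_ac)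
  show ?thesis
  proof (intro hilbert_tensor.intro hilbert_tensor_axioms.intro hilbert_space_euclidean ip)
    show "closure (module.span (*\<^sub>R) {?t f g | f g. True}) = UNIV"
      using dense by (simp only: span_raw_def)
  qed (simp_all add: vec_eq_iff algebra_simps)
qed

end

theory Submission
  imports Defs
begin

text \<open>The frame operator \<open>S\<close> of \<open>V\<close> is bounded and coercive, hence invertible with
  \<open>\<parallel>S\<inverse>\<parallel> \<le> 1 / B\<close>. Pairing the dual reconstruction formula for \<open>f\<close> with \<open>f\<close> itself and
  moving \<open>P\<^bsub>V' i\<^esub>\<close> to the other side, Cauchy--Schwarz gives
  \<open>\<parallel>f\<parallel>\<^sup>2 \<le> D / B\<^sup>2 * (\<Sum>i. (v' i)\<^sup>2 \<parallel>P\<^bsub>V' i\<^esub> f\<parallel>\<^sup>2)\<close>, so the Bessel sequence \<open>V'\<close> is a fusion frame,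
  and likewise \<open>W'\<close>. On simple tensors the projection onto \<open>X \<otimes> Y\<close> is \<open>P\<^bsub>X\<^esub> \<otimes> P\<^bsub>Y\<^esub>\<close>, so the double
  sum factors and the frame bounds multiply.\<close>

section \<open>Unordered sums: a Cauchy criterion and products of nonnegative families\<close>

text \<open>Cauchy criterion: once a finite \<open>F0\<close> nearly exhausts
  \<open>infsum g A\<close>, any block of \<open>f\<close> outside \<open>F0\<close> is small by
  \<open>le\<close>, so the partial sums form a Cauchy net and completeness gives a limit. It serves
  the frame operator series, where \<open>g\<close> controls squared norms of blocks rather than the
  norms of the terms.\<close>

lemma summable_on_norm_sum_power2_le:
  fixes f :: "'i \<Rightarrow> 'a::banach" and g :: "'i \<Rightarrow> real"
  assumes g: "g summable_on A" and nonneg: "\<And>i. i \<in> A \<Longrightarrow> 0 \<le> g i"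
    and le: "\<And>F. finite F \<Longrightarrow> F \<subseteq> A \<Longrightarrow> (norm (sum f F))\<^sup>2 \<le> sum g F"
  shows "f summable_on A"
proof -
  have "\<exists>P. eventually P (finite_subsets_at_top A) \<and>
          (\<forall>F F'. P F \<and> P F' \<longrightarrow> dist (sum f F) (sum f F') < e)" if "e > 0" for e
  proof -
    \<comment> \<open>The extra factor 1/2 gains strictness: the approximation of
      \<open>infsum g A\<close> is only within \<le> \<open>d\<close>, while the distance to
      \<open>sum f F0\<close> must be < \<open>e / 2\<close>.\<close>
    define d where "d = (e / 2)\<^sup>2 / 2"
    have d: "0 < d" "d < (e / 2)\<^sup>2"
      using that by (auto simp: d_def)
    obtain F0 where F0: "finite F0" "F0 \<subseteq> A" "dist (sum g F0) (infsum g A) \<le> d"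
      using infsum_finite_approximation[OF g d(1)] by blast
    have near: "norm (sum f F - sum f F0) < e / 2" if F: "finite F" "F0 \<subseteq> F" "F \<subseteq> A" for F
    proof -
      have "(norm (sum f F - sum f F0))\<^sup>2 = (norm (sum f (F - F0)))\<^sup>2"
        using F F0 by (simp add: sum_diff)
      also have "\<dots> \<le> sum g (F - F0)"
        using F by (intro le) auto
      also have "\<dots> = sum g F - sum g F0"
        using F F0 by (simp add: sum_diff)
      also have "sum g F \<le> infsum g A"
        using g F nonneg by (intro finite_sum_le_infsum) auto
      finally have "(norm (sum f F - sum f F0))\<^sup>2 < (e / 2)\<^sup>2"
        using F0 d by (auto simp: dist_real_def)
      then show ?thesis
        by (rule power2_less_imp_less) (use \<open>e > 0\<close> in simp)
    qed
    have "eventually (\<lambda>F. finite F \<and> F0 \<subseteq> F \<and> F \<subseteq> A) (finite_subsets_at_top A)"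
      using F0 by (auto simp: eventually_finite_subsets_at_top)
    moreover have "dist (sum f F) (sum f F') < e"
      if "finite F \<and> F0 \<subseteq> F \<and> F \<subseteq> A" "finite F' \<and> F0 \<subseteq> F' \<and> F' \<subseteq> A" for F F'
      by (rule dist_triangle_half_l[of _ "sum f F0"])
        (use near[of F] near[of F'] that in \<open>simp_all add: dist_norm norm_minus_commute\<close>)
    ultimately show ?thesis
      by (intro exI[of _ "\<lambda>F. finite F \<and> F0 \<subseteq> F \<and> F \<subseteq> A"]) simp
  qed
  then have "cauchy_filter (filtermap (sum f) (finite_subsets_at_top A))"
    by (simp add: cauchy_filter_metric_filtermap)
  then obtain L where "(sum f \<longlongrightarrow> L) (finite_subsets_at_top A)"
    using complete_uniform[of "UNIV :: 'a set"] complete_UNIV by (force simp: filterlim_def)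
  then show ?thesis
    using summable_on_def has_sum_def by blast
qed

lemma has_sum_norm_le:
  fixes f :: "'i \<Rightarrow> 'a::real_normed_vector"
  assumes "(f has_sum s) A" and "\<And>F. finite F \<Longrightarrow> F \<subseteq> A \<Longrightarrow> norm (sum f F) \<le> C"
  shows "norm s \<le> C"
proof (rule tendsto_upperbound)
  show "((\<lambda>F. norm (sum f F)) \<longlongrightarrow> norm s) (finite_subsets_at_top A)"
    using assms(1) by (auto simp: has_sum_def intro: tendsto_norm)
qed (use assms(2) in \<open>auto intro: eventually_finite_subsets_at_top_weakI\<close>)

text \<open>Tonelli: nonnegativity turns summability of the iterated sums into summability over the
  product set, after which the double sum can be evaluated one index at a time.\<close>

lemma has_sum_product_nonneg:
  fixes f :: "'i \<Rightarrow> real" and g :: "'j \<Rightarrow> real"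
  assumes f: "(f has_sum a) I" and g: "(g has_sum b) J"
    and "\<And>i. i \<in> I \<Longrightarrow> 0 \<le> f i" and "\<And>j. j \<in> J \<Longrightarrow> 0 \<le> g j"
  shows "((\<lambda>(i, j). f i * g j) has_sum a * b) (I \<times> J)"
proof -
  have inner: "((\<lambda>j. case (i, j) of (i, j) \<Rightarrow> f i * g j) has_sum f i * b) J" for i
    using has_sum_cmult_right[OF g] by simp
  have outer: "((\<lambda>i. f i * b) has_sum a * b) I"
    using has_sum_cmult_left[OF f] by simp
  have "(\<lambda>(i, j). f i * g j) summable_on I \<times> J"
    by (rule summable_on_SigmaI[OF inner has_sum_imp_summable[OF outer]]) (use assms in auto)
  with inner outer show ?thesis
    by (rule has_sum_SigmaI)
qed

section \<open>Conjugation, inner product and Cauchy-Schwarz\<close>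

lemma rcnj_0 [simp]: "rcnj (0::'k::rc_field) = 0"
  using rcnj_add[of "0::'k" 0] by simp

text \<open>For nonzero \<open>r\<close>, cancel \<open>r\<close> in the instance of
  \<open>mult_rcnj\<close> at \<open>of_real r\<close>. This is what makes the inner product
  real-homogeneous in its second argument.\<close>

lemma rcnj_of_real [simp]: "rcnj (of_real r :: 'k::rc_field) = of_real r"
proof (cases "r = 0")
  case False
  have "of_real r * rcnj (of_real r :: 'k) = of_real r * of_real r"
    using mult_rcnj[of "of_real r :: 'k"] by (simp add: scaleR_conv_of_real power2_eq_square)
  with False show ?thesis
    by simp
qed simp

context hilbert_space
begin

lemma ip_zero_left [simp]: "ip 0 y = 0"
  using ip_add_left[of 0 0 y] by simp

lemma ip_eq_0_commute: "ip x y = 0 \<longleftrightarrow> ip y x = 0"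
  by (metis ip_commute rcnj_0)

lemma ip_zero_right [simp]: "ip x 0 = 0"
  by (simp add: ip_eq_0_commute)

lemma ip_scaleR_left: "ip (r *\<^sub>R x) y = of_real r * ip x y"
  by (metis ip_scale_left scale_of_real)

lemma ip_minus_left: "ip (- x) y = - ip x y"
  using ip_scaleR_left[of "-1"] by simp

lemma ip_diff_left: "ip (x - y) z = ip x z - ip y z"
  using ip_add_left[of x "- y" z] by (simp add: ip_minus_left)

lemma ip_add_right: "ip x (y + z) = ip x y + ip x z"
  by (metis ip_add_left ip_commute rcnj_add)

lemma ip_scale_right: "ip x (scale a y) = rcnj a * ip x y"
  by (metis ip_commute ip_scale_left rcnj_mult)

lemma ip_scaleR_right: "ip x (r *\<^sub>R y) = of_real r * ip x y"
  by (metis ip_scale_right rcnj_of_real scale_of_real)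

lemma ip_diff_right: "ip x (y - z) = ip x y - ip x z"
  using ip_add_right[of x y "- z"] ip_scaleR_right[of x "-1" z] by simp

text \<open>The norm meets the inner product only through \<open>ip_self\<close>, so the identity is
  proved for squares inside the scalar field and pulled back by injectivity of
  \<open>of_real\<close>. The same device recurs in the norm identities below.\<close>

lemma norm_scale: "norm (scale a x) = norm a * norm x"
proof -
  have "of_real ((norm (scale a x))\<^sup>2) = (a * rcnj a) * of_real ((norm x)\<^sup>2)"
    by (simp only: ip_self[symmetric] ip_scale_left ip_scale_right mult_ac)
  also have "\<dots> = of_real ((norm a * norm x)\<^sup>2)"
    by (simp add: mult_rcnj scaleR_conv_of_real power_mult_distrib)
  finally show ?thesis
    by (metis of_real_eq_iff norm_ge_zero mult_nonneg_nonneg power2_eq_imp_eq)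
qed

text \<open>Assuming the inner product real makes both cross terms equal, which avoids real parts
  over the abstract field \<open>'k\<close>.\<close>

lemma norm_diff_scaleR_power2:
  assumes "ip x y = of_real q"
  shows "(norm (x - t *\<^sub>R y))\<^sup>2 = (norm x)\<^sup>2 - 2 * t * q + t\<^sup>2 * (norm y)\<^sup>2"
proof -
  have "ip y x = of_real q"
    using ip_commute[of y x] assms by simp
  then have "of_real ((norm (x - t *\<^sub>R y))\<^sup>2) =
      (of_real ((norm x)\<^sup>2 - 2 * t * q + t\<^sup>2 * (norm y)\<^sup>2) :: 'k)"
    using assms
    by (simp only: of_real_add of_real_diff of_real_mult ip_self[symmetric])
      (simp add: ip_diff_left ip_diff_right ip_scaleR_left ip_scaleR_right algebra_simps
        power2_eq_square)
  then show ?thesis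
    by (simp only: of_real_eq_iff)
qed

text \<open>Rescaling \<open>y\<close> by \<open>ip x y\<close> makes its inner product with
  \<open>x\<close> real over either field. With \<open>t\<close> the reciprocal of the squared norm
  of \<open>y\<close>, the left side is the squared length of the component of \<open>x\<close>
  orthogonal to \<open>y\<close>; this choice drives both Cauchy-Schwarz and the orthogonality of
  nearest points.\<close>

lemma norm_diff_scale_ip_power2:
  "(norm (x - t *\<^sub>R scale (ip x y) y))\<^sup>2 =
     (norm x)\<^sup>2 - 2 * t * (norm (ip x y))\<^sup>2 + t\<^sup>2 * (norm (ip x y) * norm y)\<^sup>2"
proof -
  have "ip x (scale (ip x y) y) = of_real ((norm (ip x y))\<^sup>2)"
    using mult_rcnj[of "ip x y"] by (simp add: ip_scale_right scaleR_conv_of_real mult.commute)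
  from norm_diff_scaleR_power2[OF this] show ?thesis
    by (simp add: norm_scale)
qed

lemma norm_ip_le: "norm (ip x y) \<le> norm x * norm y"
proof (cases "y = 0")
  case False
  then have "0 \<le> (norm x)\<^sup>2 - (norm (ip x y))\<^sup>2 / (norm y)\<^sup>2"
    using norm_diff_scale_ip_power2[of x "1 / (norm y)\<^sup>2" y]
      zero_le_power2[of "norm (x - (1 / (norm y)\<^sup>2) *\<^sub>R scale (ip x y) y)"]
    by (simp add: power_mult_distrib power2_eq_square)
  then have "(norm (ip x y))\<^sup>2 \<le> (norm x * norm y)\<^sup>2"
    using False by (simp add: field_simps power_mult_distrib)
  then show ?thesis
    by (rule power2_le_imp_le) simp
qed simp

lemma bounded_linear_ip_left: "bounded_linear (\<lambda>x. ip x y)"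
proof (rule bounded_linear_intro)
  show "norm (ip x y) \<le> norm x * norm y" for x
    by (rule norm_ip_le)
qed (simp_all add: ip_add_left ip_scaleR_left scaleR_conv_of_real)

lemma ip_sum_left: "ip (\<Sum>i\<in>F. f i) y = (\<Sum>i\<in>F. ip (f i) y)"
  by (rule linear_sum) (rule bounded_linear.linear[OF bounded_linear_ip_left])

section \<open>Orthogonal projections onto closed subspaces\<close>

lemma parallelogram:
  fixes x y :: 'a
  shows "(norm (x + y))\<^sup>2 + (norm (x - y))\<^sup>2 = 2 * (norm x)\<^sup>2 + 2 * (norm y)\<^sup>2"
proof -
  have "of_real ((norm (x + y))\<^sup>2 + (norm (x - y))\<^sup>2) =
      (of_real (2 * (norm x)\<^sup>2 + 2 * (norm y)\<^sup>2) :: 'k)"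
    by (simp only: of_real_add of_real_mult ip_self[symmetric])
      (simp add: ip_add_left ip_add_right ip_diff_left ip_diff_right)
  then show ?thesis
    by (simp only: of_real_eq_iff)
qed

lemma subspace_scaleR: "subspace X \<Longrightarrow> x \<in> X \<Longrightarrow> r *\<^sub>R x \<in> X"
  by (metis scale_of_real subspace_scale)

text \<open>The sets \<open>S n\<close> of near minimisers of the squared distance are closed,
  nonempty and nested, and the parallelogram law forces their diameters to 0. By completeness they
  share a point, which attains the infimum.\<close>

lemma nearest_point_exists:
  assumes X: "closed_subspace X"
  shows "\<exists>p\<in>X. \<forall>x\<in>X. norm (f - p) \<le> norm (f - x)"
proof -
  have sub: "subspace X" and cl: "closed X"
    using X by (auto simp: closed_subspace_def)
  define q where "q = (INF x\<in>X. (norm (f - x))\<^sup>2)"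
  have ne: "X \<noteq> {}"
    using subspace_0[OF sub] by auto
  have bdd: "bdd_below ((\<lambda>x. (norm (f - x))\<^sup>2) ` X)"
    by (rule bdd_belowI2[of _ 0]) simp
  have q_le: "q \<le> (norm (f - x))\<^sup>2" if "x \<in> X" for x
    unfolding q_def using bdd that by (rule cINF_lower)
  define S where "S n = {x \<in> X. (norm (f - x))\<^sup>2 \<le> q + 1 / real (Suc n)}" for n
  have small: "(dist x y)\<^sup>2 \<le> 4 / real (Suc n)" if "x \<in> S n" "y \<in> S n" for x y n
  proof -
    \<comment> \<open>The midpoint lies in \<open>X\<close>, so its squared distance to
      \<open>f\<close> is at least \<open>q\<close>; doubling the vector gives \<open>4 * q\<close>,
      which cancels in the parallelogram law for \<open>f - x\<close> and \<open>f - y\<close> and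
      leaves only the slack of the two near minimisers.\<close>
    have "(1/2) *\<^sub>R (x + y) \<in> X"
      using that sub by (auto simp: S_def intro: subspace_scaleR subspace_add)
    then have "4 * q \<le> (norm (2 *\<^sub>R (f - (1/2) *\<^sub>R (x + y))))\<^sup>2"
      using q_le by (simp add: power_mult_distrib)
    also have "2 *\<^sub>R (f - (1/2) *\<^sub>R (x + y)) = (f - x) + (f - y)"
      by (simp add: algebra_simps scaleR_2)
    finally have "4 * q + (norm (x - y))\<^sup>2 \<le> 2 * (norm (f - x))\<^sup>2 + 2 * (norm (f - y))\<^sup>2"
      using parallelogram[of "f - x" "f - y"] by (simp add: norm_minus_commute)
    with that show ?thesis
      by (auto simp: S_def dist_norm)
  qed
  have "\<exists>a. \<forall>n. a \<in> S n"
  proof (rule decreasing_closed_nest)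
    show "closed (S n)" for n
      unfolding S_def by (intro closed_Collect_conj closed_Collect_le continuous_intros)
        (simp add: cl)
    show "S n \<noteq> {}" for n
    proof -
      have "(INF x\<in>X. (norm (f - x))\<^sup>2) < q + 1 / real (Suc n)"
        by (simp add: q_def)
      then show ?thesis
        unfolding cINF_less_iff[OF ne bdd] by (auto simp: S_def intro: less_imp_le)
    qed
    show "S n \<subseteq> S m" if "m \<le> n" for m n
    proof -
      have "1 / real (Suc n) \<le> 1 / real (Suc m)"
        using that by (simp add: frac_le)
      then show ?thesis
        by (auto simp: S_def)
    qed
    show "\<exists>n. \<forall>x\<in>S n. \<forall>y\<in>S n. dist x y < e" if "e > 0" for e
    proof -
      obtain n where n: "1 / real (Suc n) < e\<^sup>2 / 4"
        using nat_approx_posE[of "e\<^sup>2 / 4"] \<open>e > 0\<close> by auto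
      have "dist x y < e" if "x \<in> S n" "y \<in> S n" for x y
        by (rule power2_less_imp_less) (use small[OF that] n \<open>e > 0\<close> in auto)
      then show ?thesis
        by blast
    qed
  qed blast
  then obtain p where p: "\<And>n. p \<in> S n"
    by blast
  have p_le: "(norm (f - p))\<^sup>2 \<le> q"
  proof (rule field_le_epsilon)
    fix e :: real
    assume "e > 0"
    then obtain n where "1 / real (Suc n) < e"
      using nat_approx_posE by blast
    with p[of n] show "(norm (f - p))\<^sup>2 \<le> q + e"
      by (auto simp: S_def)
  qed
  have "norm (f - p) \<le> norm (f - x)" if "x \<in> X" for x
    by (rule power2_le_imp_le[OF order_trans[OF p_le q_le[OF that]] norm_ge_zero])
  then show ?thesis
    using p[of 0] by (auto simp: S_def)
qed

text \<open>If \<open>c = ip (f - p) x\<close> were nonzero, moving \<open>p\<close> by the multiple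
  \<open>t * c\<close> of \<open>x\<close> would stay in \<open>X\<close> and lower the squared
  distance to \<open>f\<close> by the squared norm of \<open>c\<close> over that of
  \<open>x\<close>.\<close>

lemma nearest_point_orthogonal:
  assumes sub: "subspace X" and p: "p \<in> X" and x: "x \<in> X"
    and min: "\<And>y. y \<in> X \<Longrightarrow> norm (f - p) \<le> norm (f - y)"
  shows "ip (f - p) x = 0"
proof (rule ccontr)
  define c where "c = ip (f - p) x"
  assume "ip (f - p) x \<noteq> 0"
  then have c: "c \<noteq> 0" and x0: "x \<noteq> 0"
    by (auto simp: c_def)
  define t where "t = 1 / (norm x)\<^sup>2"
  have "p + t *\<^sub>R scale c x \<in> X"
    using sub p x by (intro subspace_add subspace_scaleR subspace_scale)
  from min[OF this] have "(norm (f - p))\<^sup>2 \<le> (norm ((f - p) - t *\<^sub>R scale c x))\<^sup>2"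
    by (simp add: diff_diff_eq power_mono)
  also have "\<dots> = (norm (f - p))\<^sup>2 - (norm c)\<^sup>2 / (norm x)\<^sup>2"
    unfolding c_def norm_diff_scale_ip_power2 using x0
    by (simp add: t_def power_mult_distrib power2_eq_square)
  finally show False
    using c x0 by (simp add: divide_le_0_iff)
qed

text \<open>\<open>proj\<close> is a definite description, so uniqueness is the point: two
  candidates differ by an element of \<open>X\<close> that is orthogonal to itself.\<close>

lemma proj_eqI:
  assumes sub: "subspace X" and p: "p \<in> X" "\<And>x. x \<in> X \<Longrightarrow> ip (f - p) x = 0"
  shows "proj X f = p"
  unfolding proj_def
proof (rule the_equality)
  fix r
  assume r: "r \<in> X \<and> (\<forall>x\<in>X. ip (f - r) x = 0)"
  then have "r - p \<in> X"
    using sub p by (simp add: subspace_diff)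
  then have "ip (f - p) (r - p) - ip (f - r) (r - p) = 0"
    using p r by simp
  then have "ip (r - p) (r - p) = 0"
    by (simp flip: ip_diff_left)
  then show "r = p"
    by (simp add: ip_self)
qed (use p in auto)

lemma
  assumes X: "closed_subspace X"
  shows proj_in: "proj X f \<in> X"
    and ip_diff_proj: "x \<in> X \<Longrightarrow> ip (f - proj X f) x = 0"
proof -
  have sub: "subspace X"
    using X by (simp add: closed_subspace_def)
  obtain p where p: "p \<in> X" "\<And>x. x \<in> X \<Longrightarrow> norm (f - p) \<le> norm (f - x)"
    using nearest_point_exists[OF X] by blast
  have orth: "ip (f - p) x = 0" if "x \<in> X" for x
    using sub p(1) that p(2) by (rule nearest_point_orthogonal)
  have "proj X f = p"
    using sub p(1) orth by (rule proj_eqI)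
  with p(1) orth show "proj X f \<in> X" and "x \<in> X \<Longrightarrow> ip (f - proj X f) x = 0"
    by auto
qed

lemma proj_add:
  assumes X: "closed_subspace X"
  shows "proj X (f + g) = proj X f + proj X g"
proof (rule proj_eqI)
  show sub: "subspace X"
    using X by (simp add: closed_subspace_def)
  show "proj X f + proj X g \<in> X"
    using sub proj_in[OF X] by (intro subspace_add)
  show "ip (f + g - (proj X f + proj X g)) x = 0" if "x \<in> X" for x
    using ip_diff_proj[OF X that, of f] ip_diff_proj[OF X that, of g]
    by (simp add: ip_add_left ip_diff_left)
qed

lemma ip_proj_left:
  assumes X: "closed_subspace X"
  shows "ip (proj X f) g = ip (proj X f) (proj X g)"
proof -
  have "ip (proj X f) (g - proj X g) = 0"
    by (subst ip_eq_0_commute) (rule ip_diff_proj[OF X proj_in[OF X]])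
  then show ?thesis
    by (simp add: ip_diff_right)
qed

lemma ip_proj_adjoint:
  assumes X: "closed_subspace X"
  shows "ip (proj X f) g = ip f (proj X g)"
  using ip_diff_proj[OF X proj_in[OF X], of f g] ip_proj_left[OF X, of f g]
  by (simp add: ip_diff_left)

section \<open>The fusion frame operator: convergence, coercivity and invertibility\<close>

lemma fusion_frameD:
  assumes "fusion_frame I V v B D"
  shows "\<And>i. i \<in> I \<Longrightarrow> closed_subspace (V i)" and "\<And>i. i \<in> I \<Longrightarrow> 0 < v i"
    and "0 < B" and "B \<le> D"
    and "\<And>f. (\<lambda>i. (v i)\<^sup>2 * (norm (proj (V i) f))\<^sup>2) summable_on I"
    and "\<And>f. B * (norm f)\<^sup>2 \<le> (\<Sum>\<^sub>\<infinity>i\<in>I. (v i)\<^sup>2 * (norm (proj (V i) f))\<^sup>2)"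
    and "\<And>f. (\<Sum>\<^sub>\<infinity>i\<in>I. (v i)\<^sup>2 * (norm (proj (V i) f))\<^sup>2) \<le> D * (norm f)\<^sup>2"
  using assms by (auto simp: fusion_frame_def weighted_subspaces_def)

lemma fusion_frame_sum_le:
  assumes frame: "fusion_frame I V v B D" and F: "finite F" "F \<subseteq> I"
  shows "(\<Sum>i\<in>F. (v i)\<^sup>2 * (norm (proj (V i) f))\<^sup>2) \<le> D * (norm f)\<^sup>2"
proof -
  have "(\<Sum>i\<in>F. (v i)\<^sup>2 * (norm (proj (V i) f))\<^sup>2) \<le>
      (\<Sum>\<^sub>\<infinity>i\<in>I. (v i)\<^sup>2 * (norm (proj (V i) f))\<^sup>2)"
    using fusion_frameD(5)[OF frame] F by (intro finite_sum_le_infsum) auto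
  also have "\<dots> \<le> D * (norm f)\<^sup>2"
    by (rule fusion_frameD(7)[OF frame])
  finally show ?thesis .
qed

text \<open>Testing the partial sum \<open>u\<close> against itself, each term \<open>\<langle>P f, u\<rangle>\<close> equals
  \<open>\<langle>P f, P u\<rangle>\<close>, so the upper frame bound applied to \<open>u\<close> controls the second factor.\<close>

lemma fusion_frame_norm_sum_le:
  assumes frame: "fusion_frame I V v B D" and F: "finite F" "F \<subseteq> I"
  shows "(norm (\<Sum>i\<in>F. (v i)\<^sup>2 *\<^sub>R proj (V i) f))\<^sup>2 \<le>
    (\<Sum>i\<in>F. D * ((v i)\<^sup>2 * (norm (proj (V i) f))\<^sup>2))"
proof -
  define u where "u = (\<Sum>i\<in>F. (v i)\<^sup>2 *\<^sub>R proj (V i) f)"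
  define s where "s = (\<Sum>i\<in>F. (v i)\<^sup>2 * (norm (proj (V i) f))\<^sup>2)"
  have D: "0 < D"
    using fusion_frameD[OF frame] by linarith
  have s0: "0 \<le> s"
    by (auto simp: s_def intro: sum_nonneg)
  have "of_real ((norm u)\<^sup>2) = (\<Sum>i\<in>F. of_real ((v i)\<^sup>2) * ip (proj (V i) f) u)"
    unfolding ip_self[symmetric] by (subst (1) u_def) (simp only: ip_sum_left ip_scaleR_left)
  also have "\<dots> = (\<Sum>i\<in>F. of_real ((v i)\<^sup>2) * ip (proj (V i) f) (proj (V i) u))"
    using F fusion_frameD(1)[OF frame] by (intro sum.cong) (auto simp: ip_proj_left[of _ _ u])
  finally have "norm (of_real ((norm u)\<^sup>2) :: 'k) \<le>
      (\<Sum>i\<in>F. norm (of_real ((v i)\<^sup>2) * ip (proj (V i) f) (proj (V i) u)))"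
    by (simp only: norm_sum)
  also have "\<dots> \<le> (\<Sum>i\<in>F. (v i * norm (proj (V i) f)) * (v i * norm (proj (V i) u)))"
  proof (rule sum_mono)
    fix i
    have "(v i)\<^sup>2 * norm (ip (proj (V i) f) (proj (V i) u)) \<le>
        (v i)\<^sup>2 * (norm (proj (V i) f) * norm (proj (V i) u))"
      by (intro mult_left_mono norm_ip_le) simp
    then show "norm (of_real ((v i)\<^sup>2) * ip (proj (V i) f) (proj (V i) u)) \<le>
        (v i * norm (proj (V i) f)) * (v i * norm (proj (V i) u))"
      by (simp only: norm_mult norm_of_real abs_power2) (simp add: power2_eq_square mult_ac)
  qed
  finally have "(norm u)\<^sup>2 \<le>
      (\<Sum>i\<in>F. (v i * norm (proj (V i) f)) * (v i * norm (proj (V i) u)))"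
    by (simp only: norm_of_real abs_power2)
  then have "((norm u)\<^sup>2)\<^sup>2 \<le>
      (\<Sum>i\<in>F. (v i * norm (proj (V i) f)) * (v i * norm (proj (V i) u)))\<^sup>2"
    by (intro power_mono) auto
  also have "\<dots> \<le> s * (\<Sum>i\<in>F. (v i)\<^sup>2 * (norm (proj (V i) u))\<^sup>2)"
    using Cauchy_Schwarz_ineq_sum[of "\<lambda>i. v i * norm (proj (V i) f)"
        "\<lambda>i. v i * norm (proj (V i) u)" F]
    by (simp add: s_def power_mult_distrib)
  also have "\<dots> \<le> s * (D * (norm u)\<^sup>2)"
    by (rule mult_left_mono[OF fusion_frame_sum_le[OF frame F] s0])
  \<comment> \<open>The estimate is quadratic in the squared norm of \<open>u\<close>; one factor
    cancels unless \<open>u = 0\<close>, where the claim is trivial.\<close>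
  finally have *: "(norm u)\<^sup>2 * (norm u)\<^sup>2 \<le> (D * s) * (norm u)\<^sup>2"
    by (simp add: power2_eq_square mult_ac)
  have "(norm u)\<^sup>2 \<le> D * s"
  proof (cases "u = 0")
    case True
    then show ?thesis
      using D s0 by simp
  next
    case False
    then show ?thesis
      by (intro mult_right_le_imp_le[OF *]) simp
  qed
  then show ?thesis
    by (simp add: u_def s_def sum_distrib_left)
qed

text \<open>Convergence has to be established before the operator means anything, as
  \<open>infsum\<close> defaults to 0. The block estimate supplies the Cauchy criterion with the
  frame terms scaled by \<open>D\<close> as majorant.\<close>

lemma fusion_frame_operator_has_sum:
  assumes frame: "fusion_frame I V v B D"
  shows "((\<lambda>i. (v i)\<^sup>2 *\<^sub>R proj (V i) f) has_sum fusion_frame_operator I V v f) I"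
proof -
  have "(\<lambda>i. (v i)\<^sup>2 *\<^sub>R proj (V i) f) summable_on I"
  proof (rule summable_on_norm_sum_power2_le)
    show "(\<lambda>i. D * ((v i)\<^sup>2 * (norm (proj (V i) f))\<^sup>2)) summable_on I"
      using fusion_frameD(5)[OF frame] by (rule summable_on_cmult_right)
    show "0 \<le> D * ((v i)\<^sup>2 * (norm (proj (V i) f))\<^sup>2)" for i
      using fusion_frameD(3,4)[OF frame] by simp
  qed (rule fusion_frame_norm_sum_le[OF frame])
  then show ?thesis
    by (simp add: fusion_frame_operator_def)
qed

lemma fusion_frame_operator_add:
  assumes frame: "fusion_frame I V v B D"
  shows "fusion_frame_operator I V v (f + g) =
    fusion_frame_operator I V v f + fusion_frame_operator I V v g"
proof -
  have "((\<lambda>i. (v i)\<^sup>2 *\<^sub>R proj (V i) f + (v i)\<^sup>2 *\<^sub>R proj (V i) g) has_sum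
      fusion_frame_operator I V v f + fusion_frame_operator I V v g) I"
    by (intro has_sum_add fusion_frame_operator_has_sum[OF frame])
  also have "?this \<longleftrightarrow> ((\<lambda>i. (v i)\<^sup>2 *\<^sub>R proj (V i) (f + g)) has_sum
      fusion_frame_operator I V v f + fusion_frame_operator I V v g) I"
    using fusion_frameD(1)[OF frame]
    by (intro has_sum_cong) (simp add: proj_add scaleR_add_right)
  finally show ?thesis
    by (rule has_sum_unique[OF fusion_frame_operator_has_sum[OF frame]])
qed

lemma norm_fusion_frame_operator_le:
  assumes frame: "fusion_frame I V v B D"
  shows "norm (fusion_frame_operator I V v f) \<le> D * norm f"
proof (rule has_sum_norm_le[OF fusion_frame_operator_has_sum[OF frame]])
  fix F
  assume F: "finite F" "F \<subseteq> I"
  have D: "0 < D"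
    using fusion_frameD[OF frame] by linarith
  have "(norm (\<Sum>i\<in>F. (v i)\<^sup>2 *\<^sub>R proj (V i) f))\<^sup>2 \<le>
      D * (\<Sum>i\<in>F. (v i)\<^sup>2 * (norm (proj (V i) f))\<^sup>2)"
    using fusion_frame_norm_sum_le[OF frame F] by (simp add: sum_distrib_left)
  also have "\<dots> \<le> D * (D * (norm f)\<^sup>2)"
    using D by (intro mult_left_mono fusion_frame_sum_le[OF frame F]) simp
  finally show "norm (\<Sum>i\<in>F. (v i)\<^sup>2 *\<^sub>R proj (V i) f) \<le> D * norm f"
    by (rule power2_le_imp_le[OF ord_le_eq_trans])
      (use D in \<open>simp_all add: power2_eq_square mult_ac\<close>)
qed

text \<open>The quadratic form of the operator is the frame sum, hence real. This carries the lower
  frame bound over to the operator, for coercivity and for the contraction estimate.\<close>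

lemma ip_fusion_frame_operator:
  assumes frame: "fusion_frame I V v B D"
  shows "ip (fusion_frame_operator I V v f) f =
    of_real (\<Sum>\<^sub>\<infinity>i\<in>I. (v i)\<^sup>2 * (norm (proj (V i) f))\<^sup>2)"
proof (rule has_sum_unique)
  show "((\<lambda>i. ip ((v i)\<^sup>2 *\<^sub>R proj (V i) f) f) has_sum ip (fusion_frame_operator I V v f) f) I"
    by (rule has_sum_bounded_linear[OF bounded_linear_ip_left
          fusion_frame_operator_has_sum[OF frame]])
  have "ip ((v i)\<^sup>2 *\<^sub>R proj (V i) f) f = of_real ((v i)\<^sup>2 * (norm (proj (V i) f))\<^sup>2)"
    if "i \<in> I" for i
    by (simp only: ip_scaleR_left ip_proj_left[OF fusion_frameD(1)[OF frame that], of f f]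
        ip_self of_real_mult)
  moreover have "((\<lambda>i. of_real ((v i)\<^sup>2 * (norm (proj (V i) f))\<^sup>2) :: 'k) has_sum
      of_real (\<Sum>\<^sub>\<infinity>i\<in>I. (v i)\<^sup>2 * (norm (proj (V i) f))\<^sup>2)) I"
    by (rule has_sum_of_real[OF has_sum_infsum[OF fusion_frameD(5)[OF frame]]])
  ultimately show "((\<lambda>i. ip ((v i)\<^sup>2 *\<^sub>R proj (V i) f) f) has_sum
      of_real (\<Sum>\<^sub>\<infinity>i\<in>I. (v i)\<^sup>2 * (norm (proj (V i) f))\<^sup>2)) I"
    by (simp cong: has_sum_cong)
qed

text \<open>Cauchy-Schwarz bounds the quadratic form by
  \<open>norm (fusion_frame_operator I V v f) * norm f\<close>; dividing by \<open>norm f\<close>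
  leaves the lower frame bound.\<close>

lemma norm_le_fusion_frame_operator:
  assumes frame: "fusion_frame I V v B D"
  shows "B * norm f \<le> norm (fusion_frame_operator I V v f)"
proof (cases "f = 0")
  case False
  have "B * (norm f)\<^sup>2 \<le> (\<Sum>\<^sub>\<infinity>i\<in>I. (v i)\<^sup>2 * (norm (proj (V i) f))\<^sup>2)"
    by (rule fusion_frameD(6)[OF frame])
  also have "\<dots> \<le> norm (ip (fusion_frame_operator I V v f) f)"
    by (simp only: ip_fusion_frame_operator[OF frame] norm_of_real abs_ge_self)
  also have "\<dots> \<le> norm (fusion_frame_operator I V v f) * norm f"
    by (rule norm_ip_le)
  finally show ?thesis
    using False by (simp add: power2_eq_square)
qed simp

text \<open>As in the Lax--Milgram theorem: for \<open>t = B / D\<^sup>2\<close> the map \<open>f \<mapsto> f - t (S f - g)\<close> is a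
  contraction, and its fixed point solves \<open>S f = g\<close>.\<close>

lemma surj_fusion_frame_operator:
  assumes frame: "fusion_frame I V v B D"
  shows "surj (fusion_frame_operator I V v)"
proof -
  let ?S = "fusion_frame_operator I V v"
  have B: "0 < B" "B \<le> D"
    using fusion_frameD[OF frame] by auto
  \<comment> \<open>This \<open>t\<close> minimises \<open>1 - 2 * t * B + t^2 * D^2\<close>, and
    the minimum is the squared contraction constant \<open>c\<close> below. \<open>B \<le> D\<close>
    keeps the radicand nonnegative and \<open>0 < B\<close> makes \<open>c < 1\<close>.\<close>
  define t where "t = B / D\<^sup>2"
  have t: "0 < t"
    using B by (simp add: t_def)
  define c where "c = sqrt (1 - (B / D)\<^sup>2)"
  have BD: "0 < B / D" "B / D \<le> 1"
    using B by auto
  then have "(B / D)\<^sup>2 \<le> 1"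
    by (simp add: power_le_one)
  then have c: "0 \<le> c" "c < 1" "c\<^sup>2 = 1 - (B / D)\<^sup>2"
    using BD by (auto simp: c_def)
  have contract: "norm (f - t *\<^sub>R ?S f) \<le> c * norm f" for f
  proof -
    define q where "q = (\<Sum>\<^sub>\<infinity>i\<in>I. (v i)\<^sup>2 * (norm (proj (V i) f))\<^sup>2)"
    have "ip f (?S f) = of_real q"
      by (subst ip_commute) (simp only: ip_fusion_frame_operator[OF frame] q_def rcnj_of_real)
    from norm_diff_scaleR_power2[OF this]
    have "(norm (f - t *\<^sub>R ?S f))\<^sup>2 = (norm f)\<^sup>2 - 2 * t * q + t\<^sup>2 * (norm (?S f))\<^sup>2" .
    also have "\<dots> \<le> (norm f)\<^sup>2 - 2 * t * (B * (norm f)\<^sup>2) + t\<^sup>2 * (D * norm f)\<^sup>2"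
      using t fusion_frameD(6)[OF frame, of f]
      by (intro add_mono diff_mono mult_left_mono power_mono
          norm_fusion_frame_operator_le[OF frame]) (auto simp: q_def)
    also have "\<dots> = (c * norm f)\<^sup>2"
      using B unfolding power_mult_distrib c(3) t_def
      by (simp add: field_simps power2_eq_square)
    finally show ?thesis
      by (rule power2_le_imp_le) (use c(1) in simp)
  qed
  have "\<exists>f. ?S f = g" for g
  proof -
    let ?\<phi> = "\<lambda>f. f - t *\<^sub>R (?S f - g)"
    have "dist (?\<phi> f) (?\<phi> h) \<le> c * dist f h" for f h
    proof -
      \<comment> \<open>By additivity \<open>g\<close> cancels in the difference of the two images,
        which becomes the contraction evaluated at \<open>f - h\<close>.\<close>
      have "?S f = ?S (f - h) + ?S h"
        using fusion_frame_operator_add[OF frame, of "f - h" h] by simp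
      then have "?\<phi> f - ?\<phi> h = (f - h) - t *\<^sub>R ?S (f - h)"
        by (simp add: algebra_simps)
      then show ?thesis
        using contract[of "f - h"] by (simp only: dist_norm)
    qed
    then obtain f where "?\<phi> f = f"
      using banach_fix_type[of c ?\<phi>] c by blast
    then have "?S f = g"
      using t by simp
    then show ?thesis ..
  qed
  then show ?thesis
    by (metis surjI)
qed

text \<open>Surjectivity makes \<open>inv\<close> a right inverse, so coercivity can be applied at
  the chosen preimage of \<open>g\<close>.\<close>

lemma norm_inv_fusion_frame_operator_le:
  assumes frame: "fusion_frame I V v B D"
  shows "norm (inv (fusion_frame_operator I V v) g) \<le> norm g / B"
proof -
  let ?f = "inv (fusion_frame_operator I V v) g"
  have "B * norm ?f \<le> norm (fusion_frame_operator I V v ?f)"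
    by (rule norm_le_fusion_frame_operator[OF frame])
  also have "fusion_frame_operator I V v ?f = g"
    by (rule surj_f_inv_f[OF surj_fusion_frame_operator[OF frame]])
  finally show ?thesis
    by (simp only: pos_le_divide_eq[OF fusion_frameD(3)[OF frame]] mult.commute)
qed

section \<open>The lower frame bound for an alternative dual\<close>

lemma alternative_dual_lower_bound:
  assumes frame: "fusion_frame I V v B D" and dual: "alternative_dual I V v V' v'"
  shows "B\<^sup>2 / D * (norm f)\<^sup>2 \<le> (\<Sum>\<^sub>\<infinity>i\<in>I. (v' i)\<^sup>2 * (norm (proj (V' i) f))\<^sup>2)"
proof -
  let ?R = "inv (fusion_frame_operator I V v)"
  define s where "s = (\<Sum>\<^sub>\<infinity>i\<in>I. (v' i)\<^sup>2 * (norm (proj (V' i) f))\<^sup>2)"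
  have B: "0 < B" "0 < D"
    using fusion_frameD[OF frame] by auto
  have V': "closed_subspace (V' i)" "0 < v' i" if "i \<in> I" for i
    using dual that
    by (auto simp: alternative_dual_def fusion_bessel_def weighted_subspaces_def)
  have summable: "(\<lambda>i. (v' i)\<^sup>2 * (norm (proj (V' i) f))\<^sup>2) summable_on I"
    using dual by (auto simp: alternative_dual_def fusion_bessel_def)
  have s0: "0 \<le> s"
    by (auto simp: s_def intro: infsum_nonneg)
  have f_sum: "((\<lambda>i. (v i * v' i) *\<^sub>R proj (V' i) (?R (proj (V i) f))) has_sum f) I"
    using dual by (auto simp: alternative_dual_def)
  have "norm (ip f f) \<le> sqrt (D * (norm f)\<^sup>2 / B\<^sup>2 * s)"
  proof (rule has_sum_norm_le[OF has_sum_bounded_linear[OF bounded_linear_ip_left f_sum]])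
    fix F
    assume F: "finite F" "F \<subseteq> I"
    \<comment> \<open>The split prepares Cauchy-Schwarz: the squares of \<open>?a\<close> are
      controlled by the upper frame bound of \<open>V\<close>, with \<open>1 / B\<close> from the
      inverse operator, and those of \<open>?b\<close> sum to at most \<open>s\<close>. The
      resulting bound is uniform in \<open>F\<close> and passes to the limit.\<close>
    let ?a = "\<lambda>i. v i * (norm (proj (V i) f) / B)" and ?b = "\<lambda>i. v' i * norm (proj (V' i) f)"
    have "norm (\<Sum>i\<in>F. ip ((v i * v' i) *\<^sub>R proj (V' i) (?R (proj (V i) f))) f) \<le>
        (\<Sum>i\<in>F. ?a i * ?b i)"
    proof (rule sum_norm_le)
      fix i
      assume "i \<in> F"
      then have i: "i \<in> I"
        using F by auto
      have pos: "0 < v i" "0 < v' i"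
        using fusion_frameD(2)[OF frame i] V'(2)[OF i] .
      have "norm (ip (?R (proj (V i) f)) (proj (V' i) f)) \<le>
          norm (proj (V i) f) / B * norm (proj (V' i) f)"
        using norm_ip_le
        by (rule order_trans)
          (intro mult_right_mono norm_inv_fusion_frame_operator_le[OF frame] norm_ge_zero)
      then have "(v i * v' i) * norm (ip (?R (proj (V i) f)) (proj (V' i) f)) \<le>
          (v i * v' i) * (norm (proj (V i) f) / B * norm (proj (V' i) f))"
        using pos by (intro mult_left_mono) auto
      then show "norm (ip ((v i * v' i) *\<^sub>R proj (V' i) (?R (proj (V i) f))) f) \<le> ?a i * ?b i"
        using pos
        by (simp add: ip_scaleR_left ip_proj_adjoint[OF V'(1)[OF i]] norm_mult mult_ac)
    qed
    also have "\<dots> \<le> sqrt ((\<Sum>i\<in>F. (?a i)\<^sup>2) * (\<Sum>i\<in>F. (?b i)\<^sup>2))"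
      by (rule real_le_rsqrt) (rule Cauchy_Schwarz_ineq_sum)
    also have "\<dots> \<le> sqrt (D * (norm f)\<^sup>2 / B\<^sup>2 * s)"
    proof (intro real_sqrt_le_mono mult_mono)
      have "(\<Sum>i\<in>F. (?a i)\<^sup>2) = (\<Sum>i\<in>F. (v i)\<^sup>2 * (norm (proj (V i) f))\<^sup>2) / B\<^sup>2"
        by (simp add: power_mult_distrib power_divide sum_divide_distrib)
      also have "\<dots> \<le> D * (norm f)\<^sup>2 / B\<^sup>2"
        by (intro divide_right_mono fusion_frame_sum_le[OF frame F]) simp
      finally show "(\<Sum>i\<in>F. (?a i)\<^sup>2) \<le> D * (norm f)\<^sup>2 / B\<^sup>2" .
      show "(\<Sum>i\<in>F. (?b i)\<^sup>2) \<le> s"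
        unfolding s_def power_mult_distrib
        using summable F by (intro finite_sum_le_infsum) auto
    qed (use B in \<open>auto intro: sum_nonneg\<close>)
    finally show "norm (\<Sum>i\<in>F. ip ((v i * v' i) *\<^sub>R proj (V' i) (?R (proj (V i) f))) f) \<le>
        sqrt (D * (norm f)\<^sup>2 / B\<^sup>2 * s)" .
  qed
  then have "(norm f)\<^sup>2 \<le> sqrt (D * (norm f)\<^sup>2 / B\<^sup>2 * s)"
    by (simp only: ip_self norm_of_real abs_power2)
  then have "((norm f)\<^sup>2)\<^sup>2 \<le> (sqrt (D * (norm f)\<^sup>2 / B\<^sup>2 * s))\<^sup>2"
    by (intro power_mono) auto
  also have "\<dots> = D * (norm f)\<^sup>2 / B\<^sup>2 * s"
    using B s0 by simp
  finally have *: "(norm f)\<^sup>2 * (norm f)\<^sup>2 \<le> (D / B\<^sup>2 * s) * (norm f)\<^sup>2"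
    by (simp add: power2_eq_square mult_ac)
  have "(norm f)\<^sup>2 \<le> D / B\<^sup>2 * s"
  proof (cases "f = 0")
    case True
    then show ?thesis
      using B s0 by simp
  next
    case False
    then show ?thesis
      by (intro mult_right_le_imp_le[OF *]) simp
  qed
  then have "B\<^sup>2 / D * (norm f)\<^sup>2 \<le> s"
    using B by (simp add: field_simps)
  then show ?thesis
    by (simp add: s_def)
qed

section \<open>Closed spans over the scalar field\<close>

lemma tendsto_scale:
  assumes "(g \<longlongrightarrow> l) F"
  shows "((\<lambda>x. scale a (g x)) \<longlongrightarrow> scale a l) F"
proof -
  have "bounded_linear (scale a)"
  proof (rule bounded_linear_intro)
    show "scale a (r *\<^sub>R x) = r *\<^sub>R scale a x" for r x
      by (simp flip: scale_of_real add: mult.commute)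
    show "norm (scale a x) \<le> norm x * norm a" for x
      by (simp add: norm_scale)
  qed (rule scale_right_distrib)
  then show ?thesis
    using assms by (rule bounded_linear.tendsto)
qed

text \<open>Addition and scaling pass to limits of sequences. Scaling is by all of
  \<open>'k\<close>, which is why \<open>tendsto_scale\<close> is used.\<close>

lemma closed_subspace_closure_span: "closed_subspace (closure (span A))"
  unfolding closed_subspace_def
proof
  show "subspace (closure (span A))"
  proof (rule subspaceI)
    show "0 \<in> closure (span A)"
      using closure_subset span_zero by blast
    show "x + y \<in> closure (span A)" if xy: "x \<in> closure (span A)" "y \<in> closure (span A)" for x y
    proof -
      obtain p q where "\<forall>n. p n \<in> span A" "p \<longlonglongrightarrow> x" "\<forall>n. q n \<in> span A" "q \<longlonglongrightarrow> y"
        using xy by (auto simp: closure_sequential)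
      then have "\<forall>n. p n + q n \<in> span A" "(\<lambda>n. p n + q n) \<longlonglongrightarrow> x + y"
        by (auto intro: span_add tendsto_add)
      then show ?thesis
        unfolding closure_sequential by (intro exI[of _ "\<lambda>n. p n + q n"]) simp
    qed
    show "scale c x \<in> closure (span A)" if x: "x \<in> closure (span A)" for c x
    proof -
      obtain p where "\<forall>n. p n \<in> span A" "p \<longlonglongrightarrow> x"
        using x by (auto simp: closure_sequential)
      then have "\<forall>n. scale c (p n) \<in> span A" "(\<lambda>n. scale c (p n)) \<longlonglongrightarrow> scale c x"
        by (auto intro: span_scale tendsto_scale)
      then show ?thesis
        unfolding closure_sequential by (intro exI[of _ "\<lambda>n. scale c (p n)"]) simp
    qed
  qed
qed simp

text \<open>Orthogonality spreads from generators by linearity and then by continuity. The argument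
  runs in the linear first slot, swapping arguments with \<open>ip_eq_0_commute\<close>.\<close>

lemma ip_eq_0_closure_span:
  assumes "\<And>a. a \<in> A \<Longrightarrow> ip z a = 0" and x: "x \<in> closure (span A)"
  shows "ip z x = 0"
proof -
  have "ip y z = 0" if "y \<in> span A" for y
    using that
  proof (induction rule: span_induct_alt)
    case (step c a y)
    then show ?case
      using assms(1) by (simp add: ip_add_left ip_scale_left ip_eq_0_commute[of a])
  qed simp
  then have "span A \<subseteq> {y. ip y z = 0}"
    by blast
  moreover have "closed {y. ip y z = 0}"
    by (intro closed_Collect_eq continuous_intros
        linear_continuous_on[OF bounded_linear_ip_left])
  ultimately have "closure (span A) \<subseteq> {y. ip y z = 0}"
    by (rule closure_minimal)
  with x show ?thesis
    using ip_eq_0_commute by blast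
qed

end

section \<open>Projections of simple tensors and the product frame\<close>

context hilbert_tensor
begin

lemma norm_tensor: "norm (tensor f g) = norm f * norm g"
proof -
  have "of_real ((norm (tensor f g))\<^sup>2) = (of_real ((norm f * norm g)\<^sup>2) :: 'k)"
    by (simp only: T.ip_self[symmetric] ip_tensor)
      (simp add: H.ip_self K.ip_self power_mult_distrib)
  then have "(norm (tensor f g))\<^sup>2 = (norm f * norm g)\<^sup>2"
    by (simp only: of_real_eq_iff)
  then show ?thesis
    by (simp add: power2_eq_imp_eq)
qed

lemma closed_subspace_tensor_subspace: "T.closed_subspace (tensor_subspace X Y)"
  unfolding tensor_subspace_def by (rule T.closed_subspace_closure_span)

text \<open>By uniqueness of projections, only orthogonality of the residual to the generators of
  \<open>tensor_subspace X Y\<close> is at stake. Against \<open>tensor x y\<close> the inner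
  products factor, and projecting \<open>f\<close> and \<open>g\<close> changes neither
  factor.\<close>

lemma proj_tensor_subspace:
  assumes X: "H.closed_subspace X" and Y: "K.closed_subspace Y"
  shows "T.proj (tensor_subspace X Y) (tensor f g) = tensor (H.proj X f) (K.proj Y g)"
proof (rule T.proj_eqI)
  show "T.subspace (tensor_subspace X Y)"
    using closed_subspace_tensor_subspace by (simp add: T.closed_subspace_def)
  show "tensor (H.proj X f) (K.proj Y g) \<in> tensor_subspace X Y"
    unfolding tensor_subspace_def
    by (intro subsetD[OF closure_subset] T.span_base)
      (use H.proj_in[OF X] K.proj_in[OF Y] in blast)
  fix z
  assume z: "z \<in> tensor_subspace X Y"
  show "ipT (tensor f g - tensor (H.proj X f) (K.proj Y g)) z = 0"
  proof (rule T.ip_eq_0_closure_span[OF _ z[unfolded tensor_subspace_def]])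
    fix a
    assume "a \<in> {tensor x y | x y. x \<in> X \<and> y \<in> Y}"
    then obtain x y where a: "a = tensor x y" and xy: "x \<in> X" "y \<in> Y"
      by blast
    have "ipH f x = ipH (H.proj X f) x" "ipK g y = ipK (K.proj Y g) y"
      using H.ip_diff_proj[OF X xy(1), of f] K.ip_diff_proj[OF Y xy(2), of g]
      by (simp_all add: H.ip_diff_left K.ip_diff_left)
    then show "ipT (tensor f g - tensor (H.proj X f) (K.proj Y g)) a = 0"
      by (simp add: a T.ip_diff_left ip_tensor)
  qed
qed

lemma tensor_fusion_frameI:
  assumes V: "H.fusion_bessel I V v" and W: "K.fusion_bessel J W w"
    and A1: "0 < A1" "\<And>f. A1 * (norm f)\<^sup>2 \<le> (\<Sum>\<^sub>\<infinity>i\<in>I. (v i)\<^sup>2 * (norm (H.proj (V i) f))\<^sup>2)"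
    and A2: "0 < A2" "\<And>g. A2 * (norm g)\<^sup>2 \<le> (\<Sum>\<^sub>\<infinity>j\<in>J. (w j)\<^sup>2 * (norm (K.proj (W j) g))\<^sup>2)"
  shows "tensor_fusion_frame I J V v W w"
proof -
  obtain C1 where C1: "C1 > 0"
      "\<And>f. (\<lambda>i. (v i)\<^sup>2 * (norm (H.proj (V i) f))\<^sup>2) summable_on I"
      "\<And>f. (\<Sum>\<^sub>\<infinity>i\<in>I. (v i)\<^sup>2 * (norm (H.proj (V i) f))\<^sup>2) \<le> C1 * (norm f)\<^sup>2"
    using V by (auto simp: H.fusion_bessel_def)
  obtain C2 where C2: "C2 > 0"
      "\<And>g. (\<lambda>j. (w j)\<^sup>2 * (norm (K.proj (W j) g))\<^sup>2) summable_on J"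
      "\<And>g. (\<Sum>\<^sub>\<infinity>j\<in>J. (w j)\<^sup>2 * (norm (K.proj (W j) g))\<^sup>2) \<le> C2 * (norm g)\<^sup>2"
    using W by (auto simp: K.fusion_bessel_def)
  have Vi: "H.closed_subspace (V i)" "0 < v i" if "i \<in> I" for i
    using V that by (auto simp: H.fusion_bessel_def H.weighted_subspaces_def)
  have Wj: "K.closed_subspace (W j)" "0 < w j" if "j \<in> J" for j
    using W that by (auto simp: K.fusion_bessel_def K.weighted_subspaces_def)
  let ?a = "\<lambda>f. \<Sum>\<^sub>\<infinity>i\<in>I. (v i)\<^sup>2 * (norm (H.proj (V i) f))\<^sup>2"
  let ?b = "\<lambda>g. \<Sum>\<^sub>\<infinity>j\<in>J. (w j)\<^sup>2 * (norm (K.proj (W j) g))\<^sup>2"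
  have sum: "((\<lambda>(i, j). (v i)\<^sup>2 * (w j)\<^sup>2 *
      (norm (T.proj (tensor_subspace (V i) (W j)) (tensor f g)))\<^sup>2) has_sum ?a f * ?b g) (I \<times> J)"
    for f g
  proof -
    have "((\<lambda>(i, j). ((v i)\<^sup>2 * (norm (H.proj (V i) f))\<^sup>2) * ((w j)\<^sup>2 * (norm (K.proj (W j) g))\<^sup>2))
        has_sum ?a f * ?b g) (I \<times> J)"
      using C1(2) C2(2) by (intro has_sum_product_nonneg has_sum_infsum) auto
    also have "?this \<longleftrightarrow> ?thesis"
      by (rule has_sum_cong)
        (auto simp: proj_tensor_subspace Vi Wj norm_tensor power_mult_distrib mult_ac)
    finally show ?thesis .
  qed
  have lower: "A1 * A2 * (norm (tensor f g))\<^sup>2 \<le> ?a f * ?b g" for f g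
  proof -
    have "(A1 * (norm f)\<^sup>2) * (A2 * (norm g)\<^sup>2) \<le> ?a f * ?b g"
      using A1 A2 by (intro mult_mono) (auto intro: infsum_nonneg)
    then show ?thesis
      by (simp add: norm_tensor power_mult_distrib mult_ac)
  qed
  \<comment> \<open>The maximum secures that the lower constant is at most the upper one: over a
    zero space the frame inequalities hold trivially and do not compare \<open>A1 * A2\<close> with
    \<open>C1 * C2\<close>.\<close>
  have upper: "?a f * ?b g \<le> max (A1 * A2) (C1 * C2) * (norm (tensor f g))\<^sup>2" for f g
  proof -
    have "?a f * ?b g \<le> (C1 * (norm f)\<^sup>2) * (C2 * (norm g)\<^sup>2)"
      using C1 C2 by (intro mult_mono) (auto intro: infsum_nonneg)
    also have "\<dots> = C1 * C2 * (norm (tensor f g))\<^sup>2"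
      by (simp add: norm_tensor power_mult_distrib mult_ac)
    also have "\<dots> \<le> max (A1 * A2) (C1 * C2) * (norm (tensor f g))\<^sup>2"
      by (intro mult_right_mono) auto
    finally show ?thesis .
  qed
  show ?thesis
    unfolding tensor_fusion_frame_def
  proof (intro conjI exI allI)
    show "T.weighted_subspaces (I \<times> J) (\<lambda>(i, j). tensor_subspace (V i) (W j))
        (\<lambda>(i, j). v i * w j)"
      using Vi(2) Wj(2) closed_subspace_tensor_subspace by (auto simp: T.weighted_subspaces_def)
    show "0 < A1 * A2"
      using A1 A2 by simp
    show "A1 * A2 \<le> max (A1 * A2) (C1 * C2)"
      by simp
  qed (use lower upper in \<open>auto simp: infsumI[OF sum] intro: has_sum_imp_summable[OF sum]\<close>)
qed

end

theorem theorem4p5: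
  fixes scaleH :: "'k::rc_field \<Rightarrow> 'a::banach \<Rightarrow> 'a" and ipH :: "'a \<Rightarrow> 'a \<Rightarrow> 'k"
    and scaleK :: "'k \<Rightarrow> 'b::banach \<Rightarrow> 'b" and ipK :: "'b \<Rightarrow> 'b \<Rightarrow> 'k"
    and scaleT :: "'k \<Rightarrow> 'c::banach \<Rightarrow> 'c" and ipT :: "'c \<Rightarrow> 'c \<Rightarrow> 'k"
    and tensor :: "'a \<Rightarrow> 'b \<Rightarrow> 'c"
    and I :: "'i set" and J :: "'j set"
    and V V' :: "'i \<Rightarrow> 'a set" and v v' :: "'i \<Rightarrow> real"
    and W W' :: "'j \<Rightarrow> 'b set" and w w' :: "'j \<Rightarrow> real"
    and B1 D1 B2 D2 :: real
  assumes "hilbert_tensor scaleH ipH scaleK ipK scaleT ipT tensor"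
    and "separable_space (euclidean :: 'a topology)"
    and "separable_space (euclidean :: 'b topology)"
    and "hilbert_space.fusion_frame scaleH ipH I V v B1 D1"
    and "hilbert_space.fusion_frame scaleK ipK J W w B2 D2"
    and "hilbert_space.alternative_dual scaleH ipH I V v V' v'"
    and "hilbert_space.alternative_dual scaleK ipK J W w W' w'"
  shows "hilbert_tensor.tensor_fusion_frame scaleT ipT tensor I J V' v' W' w'"
proof -
  interpret hilbert_tensor scaleH ipH scaleK ipK scaleT ipT tensor
    by fact
  have "0 < B1\<^sup>2 / D1" "0 < B2\<^sup>2 / D2"
    using H.fusion_frameD(3,4)[OF assms(4)] K.fusion_frameD(3,4)[OF assms(5)] by auto
  moreover have "H.fusion_bessel I V' v'" "K.fusion_bessel J W' w'"
    using assms(6,7) by (auto simp: H.alternative_dual_def K.alternative_dual_def)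
  ultimately show ?thesis
    using H.alternative_dual_lower_bound[OF assms(4,6)] K.alternative_dual_lower_bound[OF assms(5,7)]
    by (intro tensor_fusion_frameI)
qed

end
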